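(* Let $G$ be a finite group and let $(\mathcal{O}_a,\mathcal{O}_m)$ be a compatible pair of $G$-transfer systems. Then $(\mathcal{O}_a,\mathrm{Hull}(\mathcal{O}_m))$ is a compatible pair.
   Context: For a finite group $G$, a $G$-transfer system $\mathcal{O}$ is a binary relation $\to$ on the set of subgroups of $G$, refining inclusion ($K\to H$ implies $K\le H$), such that: $H\to H$ for all $H\le G$; $K\to H$ implies $gKg^{-1}\to gHg^{-1}$ for all $g\in G$; $K\to H$ and $L\le H$ imply $K\cap L\to L$; and $L\to K$, $K\to H$ imply $L\to H$. $\mathcal{O}$ is saturated if whenever $L\le K\le H\le G$ and $L\to H$ is in $\mathcal{O}$, then $K\to H$ is in $\mathcal{O}$. $\mathrm{Hull}(\mathcal{O})$ is the intersection of all saturated $G$-transfer systems containing $\mathcal{O}$. A pair $(\mathcal{O}_a,\mathcal{O}_m)$ of $G$-transfer systems is compatible if $\mathcal{O}_m\subseteq\mathcal{O}_a$ and, for all $K,J\le H\le G$, if $K\to H$ is in $\mathcal{O}_m$ and $K\cap J\to K$ is in $\mathcal{O}_a$, then $J\to H$ is in $\mathcal{O}_a$. *)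

theory Defs
  imports "HOL-Algebra.Coset"
begin

text \<open>
  A binary relation on the set of subgroups of a group is a set of pairs of carrier subsets;
  \<open>(K, H) \<in> R\<close> stands for \<open>K \<rightarrow> H\<close>, so that the containment of one transfer system in another is
  \<open>\<subseteq>\<close>. For subgroups \<open>K\<close> and \<open>H\<close> of the same group, \<open>K \<le> H\<close> is \<open>K \<subseteq> H\<close>.
\<close>

definition transfer_system :: "('a, 'b) monoid_scheme \<Rightarrow> 'a set rel \<Rightarrow> bool" where
  "transfer_system G R \<longleftrightarrow>
     (\<forall>K H. (K, H) \<in> R \<longrightarrow> subgroup K G \<and> subgroup H G \<and> K \<subseteq> H) \<and>
     (\<forall>H. subgroup H G \<longrightarrow> (H, H) \<in> R) \<and>
     (\<forall>K H. \<forall>g \<in> carrier G. (K, H) \<in> R \<longrightarrow>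
        (g <#\<^bsub>G\<^esub> K #>\<^bsub>G\<^esub> inv\<^bsub>G\<^esub> g, g <#\<^bsub>G\<^esub> H #>\<^bsub>G\<^esub> inv\<^bsub>G\<^esub> g) \<in> R) \<and>
     (\<forall>K H L. (K, H) \<in> R \<longrightarrow> subgroup L G \<longrightarrow> L \<subseteq> H \<longrightarrow> (K \<inter> L, L) \<in> R) \<and>
     (\<forall>L K H. (L, K) \<in> R \<longrightarrow> (K, H) \<in> R \<longrightarrow> (L, H) \<in> R)"

definition saturated_transfer_system :: "('a, 'b) monoid_scheme \<Rightarrow> 'a set rel \<Rightarrow> bool" where
  "saturated_transfer_system G R \<longleftrightarrow> transfer_system G R \<and>
     (\<forall>L K H. subgroup L G \<longrightarrow> subgroup K G \<longrightarrow> subgroup H G \<longrightarrow> L \<subseteq> K \<longrightarrow> K \<subseteq> H \<longrightarrow>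
        (L, H) \<in> R \<longrightarrow> (K, H) \<in> R)"

text \<open>
  For a transfer system \<open>R\<close> on a group the intersected family is nonempty: it contains the
  inclusion relation on all subgroups.
\<close>

definition Hull :: "('a, 'b) monoid_scheme \<Rightarrow> 'a set rel \<Rightarrow> 'a set rel" where
  "Hull G R = \<Inter>{S. saturated_transfer_system G S \<and> R \<subseteq> S}"

definition compatible_pair :: "('a, 'b) monoid_scheme \<Rightarrow> 'a set rel \<Rightarrow> 'a set rel \<Rightarrow> bool" where
  "compatible_pair G Oa Om \<longleftrightarrow> transfer_system G Oa \<and> transfer_system G Om \<and> Om \<subseteq> Oa \<and>
     (\<forall>H K J. subgroup H G \<longrightarrow> subgroup K G \<longrightarrow> subgroup J G \<longrightarrow> K \<subseteq> H \<longrightarrow> J \<subseteq> H \<longrightarrow>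
        (K, H) \<in> Om \<longrightarrow> (K \<inter> J, K) \<in> Oa \<longrightarrow> (J, H) \<in> Oa)"

end

theory Submission
  imports Defs
begin

text \<open>
  The saturated hull of a transfer system \<open>R\<close> can be written down in one step: \<open>K \<rightarrow> H\<close> lies in
  the hull iff some \<open>L \<le> K \<le> H\<close> satisfies \<open>L \<rightarrow> H\<close> in \<open>R\<close>. No transitive closure has to be taken,
  because restriction already makes this relation transitive
  (\<open>transfer_system_sources_enlarged\<close>).

  Given this, both parts of compatibility pass from \<open>Om\<close> to its hull. Let \<open>L \<le> K \<le> H\<close> with
  \<open>L \<rightarrow> H\<close> in \<open>Om\<close>. If \<open>K \<inter> J \<rightarrow> K\<close> is in \<open>Oa\<close>, its restriction to \<open>L\<close> is \<open>L \<inter> J \<rightarrow> L\<close>, and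
  compatibility with \<open>L \<rightarrow> H\<close> yields \<open>J \<rightarrow> H\<close>. The containment of the hull in \<open>Oa\<close> is
  the case \<open>J = K\<close>, where \<open>K \<inter> J \<rightarrow> K\<close> holds by reflexivity.
\<close>

definition sources_enlarged :: "('a, 'b) monoid_scheme \<Rightarrow> 'a set rel \<Rightarrow> 'a set rel" where
  "sources_enlarged G R =
     {(K, H). subgroup K G \<and> K \<subseteq> H \<and> (\<exists>L. L \<subseteq> K \<and> (L, H) \<in> R)}"

lemma sources_enlargedI:
  "\<lbrakk>subgroup K G; L \<subseteq> K; K \<subseteq> H; (L, H) \<in> R\<rbrakk> \<Longrightarrow> (K, H) \<in> sources_enlarged G R"
  unfolding sources_enlarged_def by blast

lemma sources_enlargedE:
  assumes "(K, H) \<in> sources_enlarged G R"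
  obtains L where "L \<subseteq> K" "(L, H) \<in> R" "subgroup K G" "K \<subseteq> H"
  using assms unfolding sources_enlarged_def by blast

lemma transfer_systemD:
  assumes "transfer_system G R"
  shows transfer_system_subgroups: "(K, H) \<in> R \<Longrightarrow> subgroup K G \<and> subgroup H G \<and> K \<subseteq> H"
    and transfer_system_refl: "subgroup H G \<Longrightarrow> (H, H) \<in> R"
    and transfer_system_conj: "\<lbrakk>(K, H) \<in> R; g \<in> carrier G\<rbrakk> \<Longrightarrow>
        (g <#\<^bsub>G\<^esub> K #>\<^bsub>G\<^esub> inv\<^bsub>G\<^esub> g, g <#\<^bsub>G\<^esub> H #>\<^bsub>G\<^esub> inv\<^bsub>G\<^esub> g) \<in> R"
    and transfer_system_restrict: "\<lbrakk>(K, H) \<in> R; subgroup L G; L \<subseteq> H\<rbrakk> \<Longrightarrow> (K \<inter> L, L) \<in> R"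
    and transfer_system_trans: "\<lbrakk>(L, K) \<in> R; (K, H) \<in> R\<rbrakk> \<Longrightarrow> (L, H) \<in> R"
  using assms unfolding transfer_system_def by (elim conjE; meson)+

lemma conj_mono: "K \<subseteq> H \<Longrightarrow> g <#\<^bsub>G\<^esub> K #>\<^bsub>G\<^esub> x \<subseteq> g <#\<^bsub>G\<^esub> H #>\<^bsub>G\<^esub> x"
  unfolding l_coset_def r_coset_def by blast

text \<open>
  Only transitivity needs an idea. If \<open>L \<rightarrow> K\<close> is witnessed by \<open>P \<le> L\<close> and \<open>K \<rightarrow> H\<close> by \<open>Q \<le> K\<close>,
  then restricting \<open>P \<rightarrow> K\<close> to \<open>Q\<close> gives \<open>P \<inter> Q \<rightarrow> Q \<rightarrow> H\<close>, so \<open>P \<inter> Q \<le> L\<close> witnesses \<open>L \<rightarrow> H\<close>.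
\<close>

lemma transfer_system_sources_enlarged:
  assumes G: "group G" and R: "transfer_system G R"
  shows "transfer_system G (sources_enlarged G R)"
  unfolding transfer_system_def
proof (intro conjI allI ballI impI)
  fix K H assume "(K, H) \<in> sources_enlarged G R"
  then show "subgroup K G" "subgroup H G" "K \<subseteq> H"
    using transfer_system_subgroups[OF R] unfolding sources_enlarged_def by auto
next
  fix H assume "subgroup H G"
  then show "(H, H) \<in> sources_enlarged G R"
    using transfer_system_refl[OF R] unfolding sources_enlarged_def by auto
next
  fix K H g assume KH: "(K, H) \<in> sources_enlarged G R" and g: "g \<in> carrier G"
  obtain L where L: "L \<subseteq> K" "(L, H) \<in> R" "subgroup K G" "K \<subseteq> H"
    using KH by (rule sources_enlargedE)
  have "(g <#\<^bsub>G\<^esub> K #>\<^bsub>G\<^esub> inv\<^bsub>G\<^esub> g, g <#\<^bsub>G\<^esub> K #>\<^bsub>G\<^esub> inv\<^bsub>G\<^esub> g) \<in> R"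
    using transfer_system_conj[OF R transfer_system_refl[OF R]] L g by blast
  then have "subgroup (g <#\<^bsub>G\<^esub> K #>\<^bsub>G\<^esub> inv\<^bsub>G\<^esub> g) G"
    using transfer_system_subgroups[OF R] by blast
  then show "(g <#\<^bsub>G\<^esub> K #>\<^bsub>G\<^esub> inv\<^bsub>G\<^esub> g, g <#\<^bsub>G\<^esub> H #>\<^bsub>G\<^esub> inv\<^bsub>G\<^esub> g) \<in> sources_enlarged G R"
    using conj_mono[OF L(1)] conj_mono[OF L(4)] transfer_system_conj[OF R L(2) g]
    by (rule sources_enlargedI)
next
  fix K H M assume KH: "(K, H) \<in> sources_enlarged G R" and M: "subgroup M G" "M \<subseteq> H"
  obtain L where L: "L \<subseteq> K" "(L, H) \<in> R" "subgroup K G" "K \<subseteq> H"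
    using KH by (rule sources_enlargedE)
  have "subgroup (K \<inter> M) G"
    using group.subgroups_Inter_pair[OF G] L(3) M(1) by blast
  moreover have "L \<inter> M \<subseteq> K \<inter> M"
    using L(1) by blast
  ultimately show "(K \<inter> M, M) \<in> sources_enlarged G R"
    using Int_lower2 transfer_system_restrict[OF R L(2) M] by (rule sources_enlargedI)
next
  fix L K H
  assume LK: "(L, K) \<in> sources_enlarged G R" and KH: "(K, H) \<in> sources_enlarged G R"
  obtain P where P: "P \<subseteq> L" "(P, K) \<in> R" "subgroup L G" "L \<subseteq> K"
    using LK by (rule sources_enlargedE)
  obtain Q where Q: "Q \<subseteq> K" "(Q, H) \<in> R" "subgroup K G" "K \<subseteq> H"
    using KH by (rule sources_enlargedE)
  have "(P \<inter> Q, Q) \<in> R"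
    using transfer_system_restrict[OF R P(2)] transfer_system_subgroups[OF R Q(2)] Q(1) by blast
  then have "(P \<inter> Q, H) \<in> R"
    using transfer_system_trans[OF R] Q(2) by blast
  moreover have "P \<inter> Q \<subseteq> L" "L \<subseteq> H"
    using P Q by auto
  ultimately show "(L, H) \<in> sources_enlarged G R"
    using P(3) by (auto intro: sources_enlargedI)
qed

lemma saturated_sources_enlarged:
  assumes "group G" and "transfer_system G R"
  shows "saturated_transfer_system G (sources_enlarged G R)"
  unfolding saturated_transfer_system_def
proof (intro conjI allI impI)
  fix L K H
  assume "subgroup K G" "L \<subseteq> K" "K \<subseteq> H" "(L, H) \<in> sources_enlarged G R"
  then show "(K, H) \<in> sources_enlarged G R"
    by (meson sources_enlargedE sources_enlargedI order_trans)
qed (rule transfer_system_sources_enlarged[OF assms])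

text \<open>
  Saturation forces every arrow of \<open>sources_enlarged G R\<close> into each saturated transfer system
  containing \<open>R\<close>, so this relation is the least such system.
\<close>

lemma Hull_eq_sources_enlarged:
  assumes G: "group G" and R: "transfer_system G R"
  shows "Hull G R = sources_enlarged G R"
proof
  have "R \<subseteq> sources_enlarged G R"
    using transfer_system_subgroups[OF R] unfolding sources_enlarged_def by blast
  then show "Hull G R \<subseteq> sources_enlarged G R"
    using saturated_sources_enlarged[OF assms] unfolding Hull_def by blast
next
  have "(K, H) \<in> S"
    if S: "saturated_transfer_system G S" "R \<subseteq> S" and KH: "(K, H) \<in> sources_enlarged G R"
    for S K H
  proof -
    obtain L where L: "L \<subseteq> K" "(L, H) \<in> R" "subgroup K G" "K \<subseteq> H"
      using KH by (rule sources_enlargedE)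
    then show ?thesis
      using S transfer_system_subgroups[OF R L(2)]
      unfolding saturated_transfer_system_def by blast
  qed
  then show "sources_enlarged G R \<subseteq> Hull G R"
    unfolding Hull_def by auto
qed

theorem corollary3p10:
  fixes G :: "('a, 'b) monoid_scheme"
    and Oa Om :: "'a set rel"
  assumes "group G"
    and "finite (carrier G)"
    and "compatible_pair G Oa Om"
  shows "compatible_pair G Oa (Hull G Om)"
proof -
  have Oa: "transfer_system G Oa" and Om: "transfer_system G Om"
    using assms(3) unfolding compatible_pair_def by auto
  have compat: "(J, H) \<in> Oa"
    if "(L, H) \<in> Om" "(L \<inter> J, L) \<in> Oa" "subgroup J G" "J \<subseteq> H" for L J H
    using assms(3) that transfer_system_subgroups[OF Om that(1)]
    unfolding compatible_pair_def by blast
  have hull_compat: "(J, H) \<in> Oa"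
    if KH: "(K, H) \<in> sources_enlarged G Om" and KJ: "(K \<inter> J, K) \<in> Oa"
      and J: "subgroup J G" "J \<subseteq> H" for K J H
  proof -
    obtain L where L: "L \<subseteq> K" "(L, H) \<in> Om" "subgroup K G" "K \<subseteq> H"
      using KH by (rule sources_enlargedE)
    have "(K \<inter> J \<inter> L, L) \<in> Oa"
      using transfer_system_restrict[OF Oa KJ] transfer_system_subgroups[OF Om L(2)] L(1) by blast
    moreover have "K \<inter> J \<inter> L = L \<inter> J"
      using L(1) by blast
    ultimately show ?thesis
      using compat[OF L(2) _ J] by simp
  qed
  have "(K, H) \<in> Oa" if KH: "(K, H) \<in> sources_enlarged G Om" for K H
    using hull_compat[OF KH, of K] transfer_system_refl[OF Oa] KH
    unfolding sources_enlarged_def by auto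
  then have "sources_enlarged G Om \<subseteq> Oa"
    by auto
  then show ?thesis
    unfolding compatible_pair_def Hull_eq_sources_enlarged[OF assms(1) Om]
    by (intro conjI allI impI Oa transfer_system_sources_enlarged[OF assms(1) Om])
      (auto intro: hull_compat)
qed

end
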